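(* Let $0<\kappa_1<1$ and let $C$ be a real number such that, for all primes $p\ge 3$, one has $2\le \mathfrak z_p\le C p^{\kappa_1}$. Then, for all primes $p\ge 3$, one has $$\mathbf M\left(\sqrt{C}\,p^{\kappa_1/2}+1,\,p\right)\cap \mathcal M_2^{\neq\square}(p)\neq\emptyset .$$
   Context: For a prime $p\ge 3$, $\mathfrak z_p$ denotes the least integer $n\ge 2$ which is not a quadratic residue modulo $p$ (i.e. the least quadratic non-residue modulo $p$). $\mathcal M_2^*(p)=\mathrm{GL}(2,\mathbb F_p)$ is the set of invertible $2\times 2$ matrices over the field $\mathbb F_p$ of $p$ elements, and $$\mathcal M_2^{\neq\square}(p)=\{A\in\mathcal M_2^*(p): A\neq B^2\text{ for all }B\in\mathcal M_2^*(p)\}.$$ For a real number $N\ge 0$, $\mathbf M(N,p)$ is the set of $2\times 2$ matrices over $\mathbb F_p$ of the form $\begin{pmatrix} a \bmod p & b\bmod p\\ c\bmod p& d\bmod p\end{pmatrix}$ with integers $0\le a,b,c,d\le N$. *)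

theory Defs
  imports "HOL-Number_Theory.Number_Theory" "HOL-Analysis.Analysis"
begin

text \<open>
  Multiples of the modulus count as squares for \<^const>\<open>QuadRes\<close>. This does not affect the minimum:
  for every prime \<open>p \<ge> 3\<close> some \<open>n\<close> with \<open>2 \<le> n < p\<close> is a non-residue.
\<close>
definition least_nonresidue :: "nat \<Rightarrow> nat" where
  "least_nonresidue p = (LEAST n. 2 \<le> n \<and> \<not> QuadRes (int p) (int n))"

text \<open>
  The field with \<open>p\<close> elements is \<^term>\<open>residue_ring (int p)\<close>, whose elements are the integers
  \<open>0, \<dots>, p - 1\<close>, so that \<open>p\<close> may be quantified. As its operations are those of a ring
  record and not of a type class, square matrices are multiplied relative to that record.
\<close>
definition mat_monoid :: "('a, 'r) ring_scheme \<Rightarrow> ('a^'n^'n) monoid" where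
  "mat_monoid R =
    \<lparr>carrier = {A. \<forall>i j. A $ i $ j \<in> carrier R},
     monoid.mult = (\<lambda>A B. \<chi> i j. \<Oplus>\<^bsub>R\<^esub>k\<in>UNIV. A $ i $ k \<otimes>\<^bsub>R\<^esub> B $ k $ j),
     one = (\<chi> i j. if i = j then \<one>\<^bsub>R\<^esub> else \<zero>\<^bsub>R\<^esub>)\<rparr>"

abbreviation mat2_mod :: "nat \<Rightarrow> (int^2^2) monoid" where
  "mat2_mod p \<equiv> mat_monoid (residue_ring (int p))"

definition GL2 :: "nat \<Rightarrow> (int^2^2) set" where
  "GL2 p = Units (mat2_mod p)"

definition GL2_nonsquares :: "nat \<Rightarrow> (int^2^2) set" where
  "GL2_nonsquares p = {A \<in> GL2 p. \<forall>B \<in> GL2 p. A \<noteq> B [^]\<^bsub>mat2_mod p\<^esub> (2::nat)}"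

definition box_matrices :: "real \<Rightarrow> nat \<Rightarrow> (int^2^2) set" where
  "box_matrices N p =
    {(\<chi> i j. E $ i $ j mod int p) | E :: int^2^2.
       \<forall>i j. 0 \<le> E $ i $ j \<and> real_of_int (E $ i $ j) \<le> N}"

end

theory Submission
  imports Defs
begin

text \<open>
  The determinant of a square is a square, so an integer matrix whose determinant is the least
  quadratic non-residue \<open>z\<close> of \<open>p\<close> is not a square modulo \<open>p\<close>; it is invertible modulo \<open>p\<close>
  because \<open>0\<close> is a square (\<open>reduce_in_GL2_nonsquares\<close>). It remains to find such a matrix with
  entries of size about \<open>\<surd>z\<close>. With
  \<open>m = \<lfloor>\<surd>z\<rfloor>\<close>, one of the products \<open>(m + 1) * (m + 1)\<close> and \<open>(m + 1) * m\<close> equals \<open>z + c\<close>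
  for some \<open>c\<close> with \<open>0 \<le> c \<le> m + 1\<close>, and the two factors on the diagonal with \<open>1\<close> and \<open>c\<close> off it
  give determinant \<open>z\<close> (\<open>small_entries_determinant\<close>). The bound \<open>z \<le> C p\<^sup>\<kappa>\<close> then turns
  \<open>m + 1 \<le> \<surd>z + 1\<close> into the size of the box.

  To compute in the matrix monoid over \<^term>\<open>residue_ring (int p)\<close>, entrywise reduction is shown
  to carry the product of integer matrices to the product of that monoid. The library's
  determinant of integer matrices and its multiplicativity then apply.
\<close>

section \<open>Small matrices of prescribed determinant\<close>

text \<open>
  The equation says that the matrix with rows \<open>a, b\<close> and \<open>c, d\<close> has determinant \<open>z\<close>; it is
  additive because subtraction of natural numbers truncates.
  Consecutive terms of \<open>m * m\<close>, \<open>(m + 1) * m\<close>, \<open>(m + 1) * (m + 1)\<close> differ by at most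
  \<open>m + 1\<close>, and \<open>z\<close> lies between the first and the last, so rounding \<open>z\<close> up to the next one
  costs at most \<open>m + 1\<close>.
\<close>
lemma small_entries_determinant:
  fixes z :: nat
  shows "\<exists>a b c d. a * d = b * c + z \<and> (\<forall>x\<in>{a, b, c, d}. real x \<le> sqrt (real z) + 1)"
proof -
  define m where "m = nat \<lfloor>sqrt (real z)\<rfloor>"
  have m_le: "real m \<le> sqrt (real z)"
    unfolding m_def by simp
  have "sqrt (real z) < real m + 1"
    unfolding m_def by (simp add: of_nat_nat)
  then have "(sqrt (real z))\<^sup>2 < (real m + 1)\<^sup>2"
    by (intro power_strict_mono) auto
  then have "real z < real ((m + 1)\<^sup>2)"
    by (simp add: add.commute)
  then have upper: "z < (m + 1) * (m + 1)"
    by (simp only: of_nat_less_iff power2_eq_square)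
  have "(real m)\<^sup>2 \<le> (sqrt (real z))\<^sup>2"
    using m_le by (intro power_mono) auto
  then have "real (m\<^sup>2) \<le> real z"
    by simp
  then have lower: "m * m \<le> z"
    by (simp only: of_nat_le_iff power2_eq_square)
  obtain c d where cd: "(m + 1) * d = 1 * c + z" "c \<le> m + 1" "d \<le> m + 1"
  proof (cases "(m + 1) * m < z")
    case True
    then show thesis
      using upper by (intro that[of "m + 1" "(m + 1) * (m + 1) - z"]) simp_all
  next
    case False
    then show thesis
      using lower by (intro that[of m "(m + 1) * m - z"]) simp_all
  qed
  have "\<forall>x\<in>{m + 1, 1, c, d}. real x \<le> sqrt (real z) + 1"
    using cd m_le by auto
  then show ?thesis
    using cd(1) by blast
qed

section \<open>The least quadratic non-residue\<close>

text \<open>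
  Squaring on the residues modulo \<open>p\<close> identifies \<open>1\<close> and \<open>-1\<close>, which differ since \<open>p \<ge> 3\<close>.
  A map of a finite set to itself that is not injective is not surjective. A missed residue is
  neither \<open>0\<close> nor \<open>1\<close>, hence at least \<open>2\<close>.
\<close>
lemma ex_nonresidue:
  fixes p :: nat
  assumes "3 \<le> p"
  shows "\<exists>n\<ge>2. \<not> QuadRes (int p) (int n)"
proof -
  define sq where "sq x = x\<^sup>2 mod int p" for x :: int
  have "sq (int p - 1) = (1 + int p * (int p - 2)) mod int p"
    by (simp add: sq_def power2_eq_square algebra_simps)
  then have "sq (int p - 1) = sq 1"
    by (simp add: sq_def)
  then have "\<not> inj_on sq {0..<int p}"
    using assms by (auto dest: inj_onD[of _ _ "int p - 1" 1])
  then have "sq ` {0..<int p} \<noteq> {0..<int p}"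
    using eq_card_imp_inj_on[of "{0..<int p}" sq] by force
  moreover have "sq ` {0..<int p} \<subseteq> {0..<int p}"
    using assms by (auto simp: sq_def)
  ultimately obtain n where n: "0 \<le> n" "n < int p" "n \<notin> sq ` {0..<int p}"
    by force
  have nonres: "\<not> QuadRes (int p) n"
  proof
    assume "QuadRes (int p) n"
    then obtain y where "y\<^sup>2 mod int p = n mod int p"
      by (auto simp: QuadRes_def unique_euclidean_semiring_class.cong_def)
    then have "sq (y mod int p) = n"
      using n by (simp add: sq_def power_mod)
    then show False
      using n assms by force
  qed
  have "QuadRes (int p) 0" "QuadRes (int p) 1"
    by (auto simp: QuadRes_def intro: exI[of _ 0] exI[of _ 1])
  then have "n \<noteq> 0" "n \<noteq> 1"
    using nonres by auto
  then show ?thesis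
    using n nonres by (intro exI[of _ "nat n"]) auto
qed

lemma not_QuadRes_least_nonresidue:
  assumes "3 \<le> p"
  shows "\<not> QuadRes (int p) (int (least_nonresidue p))"
  using LeastI_ex[OF ex_nonresidue[OF assms]] by (simp add: least_nonresidue_def)

section \<open>Reducing integer matrices\<close>

definition reduce :: "nat \<Rightarrow> int^'n^'n \<Rightarrow> int^'n^'n" where
  "reduce p A = (\<chi> i j. A $ i $ j mod int p)"

lemma (in residues) finsum_mod_eq:
  "finite S \<Longrightarrow> (\<Oplus>\<^bsub>R\<^esub>k\<in>S. f k mod m) = (\<Sum>k\<in>S. f k) mod m"
  by (induction S rule: finite_induct)
    (simp_all add: zero_cong add_cong finsum_insert Pi_def mod_in_carrier mod_simps)

lemma mult_reduce:
  assumes "2 \<le> p"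
  shows "reduce p A \<otimes>\<^bsub>mat_monoid (residue_ring (int p))\<^esub> reduce p B = reduce p (A ** B)"
proof -
  interpret residues "int p" "residue_ring (int p)"
    using assms by unfold_locales auto
  show ?thesis
    by (simp add: mat_monoid_def reduce_def vec_eq_iff matrix_matrix_mult_def mult_cong finsum_mod_eq)
qed

lemma one_reduce:
  assumes "2 \<le> p"
  shows "\<one>\<^bsub>mat_monoid (residue_ring (int p))\<^esub> = reduce p (mat 1)"
proof -
  interpret residues "int p" "residue_ring (int p)"
    using assms by unfold_locales auto
  show ?thesis
    using assms by (simp add: mat_monoid_def reduce_def vec_eq_iff mat_def res_one_eq res_zero_eq)
qed

lemma carrier_reduce:
  assumes "2 \<le> p"
  shows "carrier (mat_monoid (residue_ring (int p))) = range (reduce p)"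
proof -
  have "A \<in> range (reduce p)" if "\<And>i j. A $ i $ j \<in> {0..int p - 1}" for A
  proof
    show "A = reduce p A"
      using that by (simp add: reduce_def vec_eq_iff)
  qed simp
  then show ?thesis
    using assms by (auto simp: mat_monoid_def residue_ring_def reduce_def)
qed

lemma det_reduce_cong: "[det (reduce p A) = det A] (mod int p)"
  unfolding det_def reduce_def
  by (intro cong_sum cong_mult cong_refl cong_prod) (simp add: unique_euclidean_semiring_class.cong_def)

text \<open>Every element of the monoid is the reduction of an integer matrix \<open>E\<close>, and
  \<open>det (E ** E) = (det E)\<^sup>2\<close>.\<close>
lemma QuadRes_det_square:
  assumes "2 \<le> p" "B \<in> carrier (mat_monoid (residue_ring (int p)))"
  shows "QuadRes (int p) (det (B [^]\<^bsub>mat_monoid (residue_ring (int p))\<^esub> (2::nat)))"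
proof -
  obtain E where E: "B = reduce p E"
    using assms by (auto simp: carrier_reduce)
  have "B [^]\<^bsub>mat_monoid (residue_ring (int p))\<^esub> (2::nat) = reduce p (E ** E)"
    using assms(1) by (simp add: E nat_pow_def numeral_2_eq_2 one_reduce mult_reduce)
  then show ?thesis
    using det_reduce_cong[of p "E ** E"]
    by (auto simp: QuadRes_def det_mul power2_eq_square intro: cong_sym)
qed

text \<open>The inverse is the adjugate multiplied by an inverse of the determinant modulo \<open>p\<close>.\<close>
lemma reduce_in_GL2:
  fixes A :: "int^2^2"
  assumes "prime p" "\<not> int p dvd det A"
  shows "reduce p A \<in> GL2 p"
proof -
  have p: "2 \<le> p"
    using assms(1) by (rule prime_ge_2_nat)
  have "coprime (det A) (int p)"
    using assms by (metis coprime_commute prime_imp_coprime prime_nat_int_transfer)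
  then obtain w where w: "[det A * w = 1] (mod int p)"
    using cong_solve_coprime_int by blast
  \<comment> \<open>In the index type \<open>2\<close>, \<open>3 - i\<close> is the index other than \<open>i\<close>.\<close>
  define Adj :: "int^2^2" where
    "Adj = (\<chi> i j. w * (if i = j then A $ (3 - i) $ (3 - i) else - A $ i $ j))"
  have "A ** Adj = mat (det A * w)" "Adj ** A = mat (det A * w)"
    by (simp_all add: Adj_def vec_eq_iff matrix_matrix_mult_def mat_def forall_2 sum_2 det_2 algebra_simps)
  moreover have "reduce p (mat (det A * w)) = (reduce p (mat 1) :: int^2^2)"
    using w by (simp add: reduce_def mat_def vec_eq_iff unique_euclidean_semiring_class.cong_def)
  ultimately have "reduce p A \<otimes>\<^bsub>mat2_mod p\<^esub> reduce p Adj = \<one>\<^bsub>mat2_mod p\<^esub>"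
    "reduce p Adj \<otimes>\<^bsub>mat2_mod p\<^esub> reduce p A = \<one>\<^bsub>mat2_mod p\<^esub>"
    by (simp_all add: mult_reduce one_reduce p)
  then show ?thesis
    by (auto simp: GL2_def Units_def carrier_reduce p)
qed

text \<open>Both halves come from the determinant: it is nonzero modulo \<open>p\<close> because \<open>0\<close> is a square,
  and the determinant of a square would be a square.\<close>
lemma reduce_in_GL2_nonsquares:
  assumes "prime p" "\<not> QuadRes (int p) (det A)"
  shows "reduce p A \<in> GL2_nonsquares p"
proof -
  have p: "2 \<le> p"
    using assms(1) by (rule prime_ge_2_nat)
  have "\<not> int p dvd det A"
    using assms(2) by (auto simp: QuadRes_def cong_0_iff cong_sym_eq[of _ "det A"] dest: spec[of _ 0])
  moreover have "reduce p A \<noteq> B [^]\<^bsub>mat2_mod p\<^esub> (2::nat)" if "B \<in> GL2 p" for B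
  proof
    assume "reduce p A = B [^]\<^bsub>mat2_mod p\<^esub> (2::nat)"
    then have "QuadRes (int p) (det (reduce p A))"
      using that QuadRes_det_square[OF p, of B] by (simp add: GL2_def Units_def)
    then show False
      using assms(2) by (auto simp: QuadRes_def intro: cong_trans[OF _ det_reduce_cong])
  qed
  ultimately show ?thesis
    using reduce_in_GL2[OF assms(1)] by (auto simp: GL2_nonsquares_def)
qed

section \<open>The box contains a non-square\<close>

theorem theorem1p2:
  fixes \<kappa>\<^sub>1 C :: real
  assumes "0 < \<kappa>\<^sub>1" and "\<kappa>\<^sub>1 < 1"
    and "\<forall>p::nat. prime p \<and> 3 \<le> p \<longrightarrow>
           2 \<le> least_nonresidue p \<and> real (least_nonresidue p) \<le> C * real p powr \<kappa>\<^sub>1"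
  shows "\<forall>p::nat. prime p \<and> 3 \<le> p \<longrightarrow>
           box_matrices (sqrt C * real p powr (\<kappa>\<^sub>1 / 2) + 1) p \<inter> GL2_nonsquares p \<noteq> {}"
proof (intro allI impI, elim conjE)
  fix p :: nat
  assume p: "prime p" "3 \<le> p"
  define z where "z = least_nonresidue p"
  obtain a b c d where abcd: "a * d = b * c + z"
      "\<forall>x\<in>{a, b, c, d}. real x \<le> sqrt (real z) + 1"
    using small_entries_determinant by blast
  have "sqrt (real z) \<le> sqrt (C * real p powr \<kappa>\<^sub>1)"
    using assms(3) p by (simp add: z_def)
  also have "\<dots> = sqrt C * real p powr (\<kappa>\<^sub>1 / 2)"
    by (simp add: real_sqrt_mult powr_half_sqrt_powr)
  finally have small: "\<forall>x\<in>{a, b, c, d}. real x \<le> sqrt C * real p powr (\<kappa>\<^sub>1 / 2) + 1"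
    using abcd(2) by fastforce
  define E :: "int^2^2" where
    "E = vector [vector [int a, int b], vector [int c, int d]]"
  have "reduce p E \<in> box_matrices (sqrt C * real p powr (\<kappa>\<^sub>1 / 2) + 1) p"
    unfolding box_matrices_def reduce_def using small
    by (auto simp: E_def forall_2 intro!: exI[of _ E])
  moreover have "int a * int d = int b * int c + int z"
    using abcd(1) by (metis of_nat_add of_nat_mult)
  then have "det E = int z"
    by (simp add: E_def det_2)
  then have "reduce p E \<in> GL2_nonsquares p"
    using p not_QuadRes_least_nonresidue by (simp add: reduce_in_GL2_nonsquares z_def)
  ultimately show "box_matrices (sqrt C * real p powr (\<kappa>\<^sub>1 / 2) + 1) p \<inter> GL2_nonsquares p \<noteq> {}"
    by blast
qed

end
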